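(* Let $\mathcal{A}\otimes\mathcal{C}$ and the elements $O_i,O_{ij}$ be as defined in the context. Then for all $i,j,k\in\{1,\dots,N\}$, $$[O_{ij},O_k]+[O_{jk},O_i]+[O_{ki},O_j]=0 .$$
   Context: Let $\mathbb{K}$ be $\mathbb{R}$ or $\mathbb{C}$ and $N\ge1$. $\mathcal{A}$ is the unital associative $\mathbb{K}$-algebra generated by $x_1,\dots,x_N,p_1,\dots,p_N$ subject to the relations, for all $i,j$, $$[x_i,x_j]=0,\quad [p_i,p_j]=0,\quad \Big[\tfrac12\sum_{i=1}^N p_i^2,\,x_j\Big]=p_j,\quad \Big[\tfrac12\sum_{i=1}^N x_i^2,\,p_j\Big]=-x_j,$$ where $[a,b]=ab-ba$. Fix $\epsilon\in\{+1,-1\}$. $\mathcal{C}$ is the Clifford algebra over $\mathbb{K}$ generated by $e_1,\dots,e_N$ with $e_ie_j+e_je_i=2\epsilon\delta_{ij}$. In $\mathcal{A}\otimes\mathcal{C}$ the tensor sign is omitted, and the $e_i$ commute with all $x_j,p_j$. Put $\underline{D}=\sum_{i=1}^N e_ip_i$. A list is a finite sequence $A=a_1\cdots a_n$ of distinct elements of $\{1,\dots,N\}$; $e_A=e_{a_1}\cdots e_{a_n}$ and $\underline{x}_A=\sum_{a\in A}x_ae_a$. For a list $A$ define $$O_A=\tfrac12\big(\underline{D}\,\underline{x}_Ae_A-e_A\underline{x}_A\underline{D}-\epsilon e_A\big).$$ $O_i$ and $O_{ij}$ denote $O_A$ for the lists $A=i$ and $A=ij$ ($i\ne j$). One has $O_{ij}=-O_{ji}$;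 accordingly $O_{ii}$ is understood to be $0$. *)

theory Defs
  imports "HOL-Analysis.Analysis" "HOL-Library.Poly_Mapping"
begin

section \<open>Free algebras and monoid algebras\<close>

text \<open>
  In \<^typ>\<open>'m \<Rightarrow>\<^sub>0 'k\<close> the product is the convolution over the additively written monoid
  of keys. With words as keys this is the free unital associative algebra on the letters.
\<close>

datatype 'g word = Word (letters: "'g list")

instantiation word :: (type) monoid_add
begin
definition "0 = Word []"
definition "u + v = Word (letters u @ letters v)"
instance by standard (simp_all add: zero_word_def plus_word_def)
end

definition scalar :: "'k \<Rightarrow> ('m::monoid_add \<Rightarrow>\<^sub>0 'k::field)"
  where "scalar c = Poly_Mapping.single 0 c"

definition gen :: "'g \<Rightarrow> ('g word \<Rightarrow>\<^sub>0 'k::field)"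
  where "gen g = Poly_Mapping.single (Word [g]) 1"

definition commutator :: "'a::ring \<Rightarrow> 'a \<Rightarrow> 'a"
  where "commutator a b = a * b - b * a"

section \<open>Quotients by two-sided ideals\<close>

inductive_set tideal :: "'a::ring_1 set \<Rightarrow> 'a set" for S where
  tideal_base: "a \<in> S \<Longrightarrow> a \<in> tideal S"
| tideal_zero: "0 \<in> tideal S"
| tideal_add: "a \<in> tideal S \<Longrightarrow> b \<in> tideal S \<Longrightarrow> a + b \<in> tideal S"
| tideal_left: "a \<in> tideal S \<Longrightarrow> r * a \<in> tideal S"
| tideal_right: "a \<in> tideal S \<Longrightarrow> a * r \<in> tideal S"

definition ideal_eq :: "'a::ring_1 set \<Rightarrow> 'a \<Rightarrow> 'a \<Rightarrow> bool"
  where "ideal_eq S a b \<longleftrightarrow> a - b \<in> tideal S"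

lemma tideal_uminus: "a \<in> tideal S \<Longrightarrow> - a \<in> tideal S"
  using tideal_left[of a S "-1"] by simp

lemma ideal_eq_equivp: "equivp (ideal_eq S)"
proof (rule equivpI)
  show "reflp (ideal_eq S)"
    by (auto intro!: reflpI simp: ideal_eq_def tideal_zero)
  show "symp (ideal_eq S)"
  proof (rule sympI)
    fix a b assume "ideal_eq S a b"
    thus "ideal_eq S b a" using tideal_uminus[of "a - b" S] by (simp add: ideal_eq_def)
  qed
  show "transp (ideal_eq S)"
  proof (rule transpI)
    fix a b c assume "ideal_eq S a b" "ideal_eq S b c"
    thus "ideal_eq S a c" using tideal_add[of "a - b" S "b - c"] by (simp add: ideal_eq_def)
  qed
qed

lemma ideal_eq_refl: "ideal_eq S a a"
  by (simp add: ideal_eq_def tideal_zero)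

lemma ideal_eq_add:
  assumes "ideal_eq S a a'" "ideal_eq S b b'" shows "ideal_eq S (a + b) (a' + b')"
  using tideal_add[of "a - a'" S "b - b'"] assms by (simp add: ideal_eq_def algebra_simps)

lemma ideal_eq_uminus:
  assumes "ideal_eq S a a'" shows "ideal_eq S (- a) (- a')"
  using tideal_uminus[of "a - a'" S] assms by (simp add: ideal_eq_def)

lemma ideal_eq_diff:
  assumes "ideal_eq S a a'" "ideal_eq S b b'" shows "ideal_eq S (a - b) (a' - b')"
  using ideal_eq_add[OF assms(1) ideal_eq_uminus[OF assms(2)]] by simp

lemma ideal_eq_mult:
  assumes "ideal_eq S a a'" "ideal_eq S b b'" shows "ideal_eq S (a * b) (a' * b')"
proof -
  have "(a - a') * b + a' * (b - b') \<in> tideal S"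
    using assms by (auto simp: ideal_eq_def intro: tideal.intros)
  thus ?thesis by (simp add: ideal_eq_def algebra_simps)
qed

section \<open>The algebra generated by positions and momenta\<close>

text \<open>The index set \<open>{1, \<dots>, N}\<close> is a finite type \<open>'n\<close>, which has at least one element.\<close>

datatype 'n xp = X 'n | P 'n

definition xp_relators :: "('n::finite xp word \<Rightarrow>\<^sub>0 'k::field_char_0) set" where
  "xp_relators =
     (\<Union>i j. {commutator (gen (X i)) (gen (X j)),
             commutator (gen (P i)) (gen (P j)),
             commutator (scalar (1/2) * (\<Sum>l\<in>UNIV. gen (P l) ^ 2)) (gen (X j)) - gen (P j),
             commutator (scalar (1/2) * (\<Sum>l\<in>UNIV. gen (X l) ^ 2)) (gen (P j)) + gen (X j)})"

quotient_type (overloaded) ('n, 'k) xp_alg =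
  "'n::finite xp word \<Rightarrow>\<^sub>0 'k::field_char_0" / "ideal_eq xp_relators"
  by (rule ideal_eq_equivp)

text \<open>
  The quotient algebras are not instances of \<^class>\<open>ring_1\<close>, because that class demands
  \<open>0 \<noteq> 1\<close>.
\<close>

instantiation xp_alg :: (finite, field_char_0) "{ring, monoid_mult}"
begin
lift_definition zero_xp_alg :: "('a, 'b) xp_alg" is 0 .
lift_definition one_xp_alg :: "('a, 'b) xp_alg" is 1 .
lift_definition plus_xp_alg :: "('a, 'b) xp_alg \<Rightarrow> ('a, 'b) xp_alg \<Rightarrow> ('a, 'b) xp_alg"
  is "(+)" by (rule ideal_eq_add)
lift_definition minus_xp_alg :: "('a, 'b) xp_alg \<Rightarrow> ('a, 'b) xp_alg \<Rightarrow> ('a, 'b) xp_alg"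
  is "(-)" by (rule ideal_eq_diff)
lift_definition uminus_xp_alg :: "('a, 'b) xp_alg \<Rightarrow> ('a, 'b) xp_alg"
  is uminus by (rule ideal_eq_uminus)
lift_definition times_xp_alg :: "('a, 'b) xp_alg \<Rightarrow> ('a, 'b) xp_alg \<Rightarrow> ('a, 'b) xp_alg"
  is "(*)" by (rule ideal_eq_mult)
instance
  by standard (transfer; simp add: algebra_simps ideal_eq_refl)+
end

lift_definition xp_scale :: "'k \<Rightarrow> ('n::finite, 'k::field_char_0) xp_alg \<Rightarrow> ('n, 'k) xp_alg"
  is "\<lambda>c a. scalar c * a" by (rule ideal_eq_mult[OF ideal_eq_refl])

lift_definition xp_x :: "'n::finite \<Rightarrow> ('n, 'k::field_char_0) xp_alg" is "\<lambda>i. gen (X i)" .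
lift_definition xp_p :: "'n::finite \<Rightarrow> ('n, 'k::field_char_0) xp_alg" is "\<lambda>i. gen (P i)" .

section \<open>The Clifford algebra\<close>

text \<open>
  The sign \<open>\<epsilon>\<close> is a parameter of the algebra, hence of its type. It is encoded by a phantom
  type \<open>'s\<close> of class \<open>sign\<close>, in the same way as the class \<open>len\<close> of HOL-Library encodes word lengths.
  Both signs occur.
\<close>

class sign =
  fixes sign_of :: "'a itself \<Rightarrow> int"
  assumes sign_of_cases: "sign_of TYPE('a) = 1 \<or> sign_of TYPE('a) = - 1"

datatype plus_sign = Plus_Sign
datatype minus_sign = Minus_Sign

instantiation plus_sign :: sign
begin
definition "sign_of (_ :: plus_sign itself) = 1"
instance by standard (simp add: sign_of_plus_sign_def)
end

instantiation minus_sign :: sign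
begin
definition "sign_of (_ :: minus_sign itself) = - 1"
instance by standard (simp add: sign_of_minus_sign_def)
end

definition clifford_relators :: "'s::sign itself \<Rightarrow> ('n::finite word \<Rightarrow>\<^sub>0 'k::field_char_0) set" where
  "clifford_relators s =
     (\<Union>i j. {gen i * gen j + gen j * gen i
               - scalar (2 * of_int (sign_of s) * (if i = j then 1 else 0))})"

quotient_type (overloaded) ('n, 's, 'k) clifford =
  "'n::finite word \<Rightarrow>\<^sub>0 'k::field_char_0" / "ideal_eq (clifford_relators TYPE('s::sign))"
  by (rule ideal_eq_equivp)

instantiation clifford :: (finite, sign, field_char_0) "{ring, monoid_mult}"
begin
lift_definition zero_clifford :: "('a, 'b, 'c) clifford" is 0 .
lift_definition one_clifford :: "('a, 'b, 'c) clifford" is 1 .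
lift_definition plus_clifford :: "('a, 'b, 'c) clifford \<Rightarrow> ('a, 'b, 'c) clifford \<Rightarrow> ('a, 'b, 'c) clifford"
  is "(+)" by (rule ideal_eq_add)
lift_definition minus_clifford :: "('a, 'b, 'c) clifford \<Rightarrow> ('a, 'b, 'c) clifford \<Rightarrow> ('a, 'b, 'c) clifford"
  is "(-)" by (rule ideal_eq_diff)
lift_definition uminus_clifford :: "('a, 'b, 'c) clifford \<Rightarrow> ('a, 'b, 'c) clifford"
  is uminus by (rule ideal_eq_uminus)
lift_definition times_clifford :: "('a, 'b, 'c) clifford \<Rightarrow> ('a, 'b, 'c) clifford \<Rightarrow> ('a, 'b, 'c) clifford"
  is "(*)" by (rule ideal_eq_mult)
instance
  by standard (transfer; simp add: algebra_simps ideal_eq_refl)+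
end

lift_definition clifford_scale ::
    "'k \<Rightarrow> ('n::finite, 's::sign, 'k::field_char_0) clifford \<Rightarrow> ('n, 's, 'k) clifford"
  is "\<lambda>c a. scalar c * a" by (rule ideal_eq_mult[OF ideal_eq_refl])

lift_definition clifford_e :: "'n::finite \<Rightarrow> ('n, 's::sign, 'k::field_char_0) clifford"
  is "\<lambda>i. gen i" .

section \<open>The tensor product of the two algebras\<close>

datatype ('a, 'c) pure = Pure 'a 'c

instantiation pure :: (monoid_mult, monoid_mult) monoid_add
begin
definition "0 = Pure 1 1"
fun plus_pure :: "('a, 'b) pure \<Rightarrow> ('a, 'b) pure \<Rightarrow> ('a, 'b) pure"
  where "Pure a c + Pure a' c' = Pure (a * a') (c * c')"
instance
proof
  fix u v w :: "('a, 'b) pure"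
  show "u + v + w = u + (v + w)"
    by (cases u; cases v; cases w) (simp add: mult.assoc)
  show "0 + u = u" "u + 0 = u"
    by (cases u; simp add: zero_pure_def)+
qed
end

text \<open>
  In the monoid algebra of pairs, whose underlying space is the free vector space on
  \<open>A \<times> C\<close>, the linear span of the bilinearity relators is already a two-sided ideal, because
  multiplying a relator by a pair gives a relator. The quotient below is therefore the usual
  tensor product of algebras.
\<close>

definition tensor_relators ::
    "('k \<Rightarrow> 'a \<Rightarrow> 'a) \<Rightarrow> ('k \<Rightarrow> 'c \<Rightarrow> 'c)
     \<Rightarrow> (('a::{ring, monoid_mult}, 'c::{ring, monoid_mult}) pure \<Rightarrow>\<^sub>0 'k::field) set" where
  "tensor_relators scale_a scale_c =
     (let t = (\<lambda>a c. Poly_Mapping.single (Pure a c) 1) in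
       (\<Union>a a' c. {t (a + a') c - t a c - t a' c}) \<union>
       (\<Union>a c c'. {t a (c + c') - t a c - t a c'}) \<union>
       (\<Union>r a c. {t (scale_a r a) c - scalar r * t a c}) \<union>
       (\<Union>r a c. {t a (scale_c r c) - scalar r * t a c}))"

quotient_type (overloaded) ('n, 's, 'k) xp_clifford =
  "(('n::finite, 'k::field_char_0) xp_alg, ('n, 's::sign, 'k) clifford) pure \<Rightarrow>\<^sub>0 'k"
  / "ideal_eq (tensor_relators xp_scale clifford_scale)"
  by (rule ideal_eq_equivp)

instantiation xp_clifford :: (finite, sign, field_char_0) "{ring, monoid_mult}"
begin
lift_definition zero_xp_clifford :: "('a, 'b, 'c) xp_clifford" is 0 .
lift_definition one_xp_clifford :: "('a, 'b, 'c) xp_clifford" is 1 .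
lift_definition plus_xp_clifford ::
    "('a, 'b, 'c) xp_clifford \<Rightarrow> ('a, 'b, 'c) xp_clifford \<Rightarrow> ('a, 'b, 'c) xp_clifford"
  is "(+)" by (rule ideal_eq_add)
lift_definition minus_xp_clifford ::
    "('a, 'b, 'c) xp_clifford \<Rightarrow> ('a, 'b, 'c) xp_clifford \<Rightarrow> ('a, 'b, 'c) xp_clifford"
  is "(-)" by (rule ideal_eq_diff)
lift_definition uminus_xp_clifford :: "('a, 'b, 'c) xp_clifford \<Rightarrow> ('a, 'b, 'c) xp_clifford"
  is uminus by (rule ideal_eq_uminus)
lift_definition times_xp_clifford ::
    "('a, 'b, 'c) xp_clifford \<Rightarrow> ('a, 'b, 'c) xp_clifford \<Rightarrow> ('a, 'b, 'c) xp_clifford"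
  is "(*)" by (rule ideal_eq_mult)
instance
  by standard (transfer; simp add: algebra_simps ideal_eq_refl)+
end

lift_definition tensor_scale ::
    "'k \<Rightarrow> ('n::finite, 's::sign, 'k::field_char_0) xp_clifford \<Rightarrow> ('n, 's, 'k) xp_clifford"
  is "\<lambda>r t. scalar r * t" by (rule ideal_eq_mult[OF ideal_eq_refl])

definition tensor ::
    "('n::finite, 'k::field_char_0) xp_alg \<Rightarrow> ('n, 's::sign, 'k) clifford \<Rightarrow> ('n, 's, 'k) xp_clifford"
  where "tensor a c = abs_xp_clifford (Poly_Mapping.single (Pure a c) 1)"

section \<open>The elements \<open>O\<^sub>A\<close>\<close>

definition xx :: "'n::finite \<Rightarrow> ('n, 's::sign, 'k::field_char_0) xp_clifford"
  where "xx i = tensor (xp_x i) 1"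

definition pp :: "'n::finite \<Rightarrow> ('n, 's::sign, 'k::field_char_0) xp_clifford"
  where "pp i = tensor (xp_p i) 1"

definition ee :: "'n::finite \<Rightarrow> ('n, 's::sign, 'k::field_char_0) xp_clifford"
  where "ee i = tensor 1 (clifford_e i)"

definition DD :: "('n::finite, 's::sign, 'k::field_char_0) xp_clifford"
  where "DD = (\<Sum>i\<in>UNIV. ee i * pp i)"

definition e_list :: "'n::finite list \<Rightarrow> ('n, 's::sign, 'k::field_char_0) xp_clifford"
  where "e_list A = prod_list (map ee A)"

definition x_list :: "'n::finite list \<Rightarrow> ('n, 's::sign, 'k::field_char_0) xp_clifford"
  where "x_list A = (\<Sum>a\<in>set A. xx a * ee a)"

text \<open>Only used for lists without repetitions.\<close>

definition O_list :: "'n::finite list \<Rightarrow> ('n, 's::sign, 'k::field_char_0) xp_clifford" where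
  "O_list A =
     tensor_scale (1/2)
       (DD * x_list A * e_list A - e_list A * x_list A * DD
        - tensor_scale (of_int (sign_of TYPE('s))) (e_list A))"

definition O1 :: "'n::finite \<Rightarrow> ('n, 's::sign, 'k::field_char_0) xp_clifford"
  where "O1 i = O_list [i]"

text \<open>
  The convention for \<open>i = j\<close> is part of the definition: \<open>[i, i]\<close> has a repetition.
\<close>

definition O2 :: "'n::finite \<Rightarrow> 'n \<Rightarrow> ('n, 's::sign, 'k::field_char_0) xp_clifford"
  where "O2 i j = (if i = j then 0 else O_list [i, j])"

text \<open>
  Everything above makes sense over any field of characteristic 0. The case of \<open>\<real>\<close> or \<open>\<complex>\<close>
  is the sort \<^class>\<open>real_normed_field\<close>: both are instances, and by the theorem of Gelfand and
  Mazur every instance is isomorphic to one of them.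
\<close>

end

theory Submission
  imports Defs
begin

text \<open>
  Put \<open>U\<^sub>k = [D, x\<^sub>k] - e\<^sub>k\<close>, \<open>Z\<^sub>i\<^sub>j = x\<^sub>i e\<^sub>j - x\<^sub>j e\<^sub>i\<close> and \<open>V\<^sub>i\<^sub>j = {D, Z\<^sub>i\<^sub>j} - e\<^sub>i e\<^sub>j\<close>.
  For \<open>i \<noteq> j\<close> one has \<open>2 O\<^sub>k = \<epsilon> U\<^sub>k\<close> and \<open>2 O\<^sub>i\<^sub>j = \<epsilon> V\<^sub>i\<^sub>j\<close>. Since \<open>D\<^sup>2 = \<epsilon> \<Sum>p\<^sub>l\<^sup>2\<close> and
  \<open>{D, e\<^sub>k} = 2 \<epsilon> p\<^sub>k\<close>, the element \<open>U\<^sub>k\<close> anticommutes with \<open>D\<close>, so that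
  \<open>[V\<^sub>i\<^sub>j, U\<^sub>k] = [D, {Z\<^sub>i\<^sub>j, U\<^sub>k}] - [e\<^sub>i e\<^sub>j, U\<^sub>k]\<close>. For distinct indices both \<open>{Z\<^sub>i\<^sub>j, U\<^sub>k}\<close> and
  \<open>[e\<^sub>i e\<^sub>j, U\<^sub>k]\<close> have zero cyclic sum, because \<open>[U\<^sub>k, x\<^sub>i]\<close> and \<open>{e\<^sub>j, U\<^sub>k} = 2 \<epsilon> [p\<^sub>j, x\<^sub>k]\<close> are
  symmetric in their two indices, by the Jacobi identity. If two indices agree, the claim is
  the antisymmetry of \<open>V\<close>.
\<close>

section \<open>The relations in an abstract ring, with the scalars 1/2 and \<epsilon> as ring
  elements\<close>

locale clifford_momenta =
  fixes x p e :: "'n::finite \<Rightarrow> 'a::{ring, monoid_mult}" and eps half :: 'a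
  assumes x_x: "x i * x j = x j * x i"
    and p_p: "p i * p j = p j * p i"
    and x_e: "x i * e j = e j * x i"
    and p_e: "p i * e j = e j * p i"
    and e_e: "e i * e j + e j * e i = (if i = j then eps + eps else 0)"
    and laplace_x: "commutator (\<Sum>l\<in>UNIV. p l * p l) (x j) = p j + p j"
    and eps_cases: "eps = 1 \<or> eps = - 1"
    and half_central: "half * a = a * half"
    and half_add_half: "half + half = 1"
begin

text \<open>Multiplication by \<open>half\<close> undoes the doubling. Facts such as
  \<open>e_square\<close> and \<open>D_square\<close> are proved doubled, because the relations for
  \<open>e\<close> give anticommutators.\<close>

lemma double_cancel:
  fixes a b :: 'a
  assumes "a + a = b + b"
  shows "a = b"
proof -
  have "half * (a + a) = half * (b + b)" using assms by simp
  hence "(half + half) * a = (half + half) * b" by (simp add: algebra_simps)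
  thus ?thesis by (simp add: half_add_half)
qed

lemma eps_central: "a * eps = eps * a"
  using eps_cases by auto

lemma e_square: "e i * e i = eps"
  by (rule double_cancel) (simp add: e_e)

lemma e_anticommute: "i \<noteq> j \<Longrightarrow> e i * e j = - (e j * e i)"
  using e_e[of i j] by (simp add: eq_neg_iff_add_eq_0)

definition D :: 'a where "D = (\<Sum>l\<in>UNIV. e l * p l)"

lemma D_p: "D * p i = p i * D"
proof -
  have "e l * p l * p i = p i * (e l * p l)" for l
    by (metis mult.assoc p_e p_p)
  thus ?thesis by (simp add: D_def sum_distrib_left sum_distrib_right)
qed

lemma D_e: "D * e j + e j * D = eps * (p j + p j)"
proof -
  have "e l * p l * e j + e j * (e l * p l) = (if l = j then eps * (p j + p j) else 0)" for l
  proof -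
    have "e l * p l * e j + e j * (e l * p l) = (e l * e j + e j * e l) * p l"
      by (simp add: distrib_right mult.assoc p_e)
    thus ?thesis by (simp add: e_e distrib_left distrib_right)
  qed
  hence "D * e j + e j * D = (\<Sum>l\<in>UNIV. if l = j then eps * (p j + p j) else 0)"
    by (simp add: D_def sum_distrib_left sum_distrib_right flip: sum.distrib)
  thus ?thesis by simp
qed

text \<open>Since \<open>D\<close> commutes with \<open>p l\<close>, its anticommutator with
  \<open>e l * p l\<close> is \<open>{D, e l} * p l\<close>, which \<open>D_e\<close> evaluates.
  Summing over \<open>l\<close> gives twice the claim, without expanding a double sum.\<close>

lemma D_square: "D * D = eps * (\<Sum>l\<in>UNIV. p l * p l)"
proof (rule double_cancel)
  have "D * (e l * p l) + e l * p l * D = eps * (p l * p l) + eps * (p l * p l)" for l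
  proof -
    have "D * (e l * p l) + e l * p l * D = (D * e l + e l * D) * p l"
      by (simp add: distrib_right mult.assoc D_p)
    thus ?thesis unfolding D_e by (simp add: algebra_simps)
  qed
  hence "(\<Sum>l\<in>UNIV. D * (e l * p l) + e l * p l * D) =
      (\<Sum>l\<in>UNIV. eps * (p l * p l) + eps * (p l * p l))" by simp
  thus "D * D + D * D = eps * (\<Sum>l\<in>UNIV. p l * p l) + eps * (\<Sum>l\<in>UNIV. p l * p l)"
    by (simp add: sum.distrib D_def flip: sum_distrib_left sum_distrib_right)
qed

text \<open>Twice \<open>[p a, x b]\<close> is \<open>[[H, x a], x b]\<close>, symmetric by Jacobi
  since the \<open>x\<close> commute. The value of \<open>[p i, x j]\<close> is not prescribed; this
  symmetry takes the place of canonical commutation relations.\<close>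

lemma commutator_p_x_sym: "commutator (p i) (x j) = commutator (p j) (x i)"
proof (rule double_cancel)
  define H where "H = (\<Sum>l\<in>UNIV. p l * p l)"
  have dbl: "commutator (p a) (x b) + commutator (p a) (x b)
      = commutator (commutator H (x a)) (x b)" for a b
    unfolding H_def laplace_x by (simp add: commutator_def algebra_simps)
  have "commutator (commutator H (x i)) (x j) = commutator (commutator H (x j)) (x i)"
    using x_x[of i j] by (simp add: commutator_def algebra_simps flip: mult.assoc)
      (simp add: mult.assoc)
  thus "commutator (p i) (x j) + commutator (p i) (x j)
      = commutator (p j) (x i) + commutator (p j) (x i)" by (simp add: dbl)
qed

section \<open>The elements U and V and their cyclic identity\<close>

definition U :: "'n \<Rightarrow> 'a" where "U k = commutator D (x k) - e k"
definition Z :: "'n \<Rightarrow> 'n \<Rightarrow> 'a" where "Z i j = x i * e j - x j * e i"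
definition V :: "'n \<Rightarrow> 'n \<Rightarrow> 'a" where "V i j = D * Z i j + Z i j * D - e i * e j"

text \<open>Both \<open>[D * D, x k]\<close> and \<open>{D, e k}\<close> equal 2 \<epsilon>
  \<open>p k\<close>. The summand \<open>- e k\<close> of \<open>U k\<close> makes them
  cancel.\<close>

lemma D_U: "D * U k = - (U k * D)"
proof -
  have "D * U k + U k * D = commutator (D * D) (x k) - (D * e k + e k * D)"
    by (simp add: U_def commutator_def algebra_simps)
  also have "commutator (D * D) (x k) = eps * commutator (\<Sum>l\<in>UNIV. p l * p l) (x k)"
    unfolding D_square by (simp add: commutator_def right_diff_distrib mult.assoc flip: eps_central)
  finally show ?thesis
    by (simp add: laplace_x D_e eq_neg_iff_add_eq_0)
qed

text \<open>The part \<open>- e k\<close> of \<open>U k\<close> commutes with \<open>x i\<close>, so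
  only the double commutator \<open>[[D, x k], x i]\<close> remains.\<close>

lemma commutator_U_x_sym: "commutator (U k) (x i) = commutator (U i) (x k)"
proof -
  have "commutator (U a) (x b) = commutator (commutator D (x a)) (x b)" for a b
    by (simp add: U_def commutator_def algebra_simps x_e)
  moreover have "commutator (commutator D (x k)) (x i) = commutator (commutator D (x i)) (x k)"
    using x_x[of i k] by (simp add: commutator_def algebra_simps flip: mult.assoc)
      (simp add: mult.assoc)
  ultimately show ?thesis by simp
qed

text \<open>The value of the anticommutator of \<open>e j\<close> and \<open>U k\<close> for
  distinct indices.\<close>

definition G :: "'n \<Rightarrow> 'n \<Rightarrow> 'a" where
  "G j k = eps * (commutator (p j) (x k) + commutator (p j) (x k))"

lemma G_sym: "G j k = G k j"
  by (simp add: G_def commutator_p_x_sym[of j k])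

text \<open>As \<open>x k\<close> commutes with \<open>e j\<close>, \<open>{e j, [D, x k]}\<close>
  is \<open>[{D, e j}, x k]\<close>, while \<open>{e j, e k}\<close> vanishes. The form is a rule
  for moving \<open>e j\<close> to the right past \<open>U k\<close>.\<close>

lemma e_U:
  assumes "j \<noteq> k"
  shows "e j * U k = G j k - U k * e j"
proof -
  have "e j * U k + U k * e j = commutator (D * e j + e j * D) (x k) - (e j * e k + e k * e j)"
    by (simp add: U_def commutator_def algebra_simps x_e)
       (simp add: x_e flip: mult.assoc)
  also have "\<dots> = G j k"
    unfolding D_e using assms eps_central[of "x k"]
    by (simp add: e_e G_def commutator_def algebra_simps) (simp flip: mult.assoc)
  finally show ?thesis by (simp add: eq_diff_eq)
qed

text \<open>Moving \<open>e j\<close> past \<open>U k\<close> changes the sign, so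
  \<open>{x i * e j, U k}\<close> is \<open>x i * G j k\<close> plus
  \<open>[U k, x i] * e j\<close>. Each coefficient is now symmetric in its two indices.\<close>

lemma Z_U:
  assumes "i \<noteq> k" "j \<noteq> k"
  shows "Z i j * U k + U k * Z i j =
    x i * G j k - x j * G i k + commutator (U k) (x i) * e j - commutator (U k) (x j) * e i"
  by (simp add: Z_def left_diff_distrib right_diff_distrib mult.assoc e_U assms commutator_def)

lemma ee_U:
  assumes "i \<noteq> k" "j \<noteq> k"
  shows "commutator (e i * e j) (U k) = e i * G j k - G i k * e j"
proof -
  have "e i * (e j * U k) = e i * G j k - (e i * U k) * e j"
    unfolding e_U[OF assms(2)] by (simp add: right_diff_distrib mult.assoc)
  also have "\<dots> = e i * G j k - G i k * e j + U k * (e i * e j)"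
    unfolding e_U[OF assms(1)] by (simp add: algebra_simps)
  finally show ?thesis by (simp add: commutator_def mult.assoc)
qed

lemma G_e: "G i k * e j = e j * G i k"
proof -
  have "p i * x k * e j = e j * (p i * x k)" "x k * p i * e j = e j * (x k * p i)"
    by (metis mult.assoc p_e x_e)+
  thus ?thesis
    by (simp add: G_def commutator_def distrib_left distrib_right left_diff_distrib
      right_diff_distrib mult.assoc) (simp add: eps_central flip: mult.assoc)
qed

text \<open>A graded Jacobi identity for \<open>[{D, Z}, U]\<close>: its remaining term drops out
  because \<open>D\<close> and \<open>U k\<close> anticommute.\<close>

lemma commutator_V_U:
  "commutator (V i j) (U k) =
    commutator D (Z i j * U k + U k * Z i j) - commutator (e i * e j) (U k)"
proof -
  have "Z i j * D * U k = - (Z i j * U k * D)"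
    by (simp add: mult.assoc D_U)
  moreover have "U k * D * Z i j = - (D * U k * Z i j)"
    by (simp add: D_U)
  ultimately show ?thesis
    by (simp add: V_def commutator_def algebra_simps)
qed

lemma cyclic_V_U:
  assumes "i \<noteq> j" "j \<noteq> k" "i \<noteq> k"
  shows "commutator (V i j) (U k) + commutator (V j k) (U i) + commutator (V k i) (U j) = 0"
proof -
  \<comment> \<open>The terms cancel in pairs: for instance \<open>e j\<close> has the coefficient
    \<open>[U k, x i] - [U i, x k]\<close>, and \<open>x i\<close> occurs with
    \<open>G j k - G k j\<close>.\<close>
  have Z: "(Z i j * U k + U k * Z i j) + (Z j k * U i + U i * Z j k) + (Z k i * U j + U j * Z k i) = 0"
    using assms assms[symmetric]
    by (simp add: Z_U commutator_U_x_sym[of k i] commutator_U_x_sym[of k j]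
      commutator_U_x_sym[of j i] G_sym[of k i] G_sym[of k j] G_sym[of j i])
  \<comment> \<open>Here a pair such as \<open>e i * G j k\<close> and \<open>G k j * e i\<close>
    cancels only after \<open>G\<close> is moved past \<open>e\<close>.\<close>
  have E: "commutator (e i * e j) (U k) + commutator (e j * e k) (U i) + commutator (e k * e i) (U j) = 0"
    using assms assms[symmetric]
    by (simp add: ee_U G_e G_sym[of k i] G_sym[of k j] G_sym[of j i])
  have "commutator (V i j) (U k) + commutator (V j k) (U i) + commutator (V k i) (U j) =
    commutator D ((Z i j * U k + U k * Z i j) + (Z j k * U i + U i * Z j k) + (Z k i * U j + U j * Z k i))
    - (commutator (e i * e j) (U k) + commutator (e j * e k) (U i) + commutator (e k * e i) (U j))"
    unfolding commutator_V_U by (simp add: commutator_def[of D] algebra_simps)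
  thus ?thesis unfolding Z E by (simp add: commutator_def)
qed

lemma V_antisym: "i \<noteq> j \<Longrightarrow> V j i = - V i j"
  using e_anticommute[of i j] by (simp add: V_def Z_def algebra_simps)

section \<open>The elements O in terms of U and V\<close>

definition O_elem :: "'n list \<Rightarrow> 'a" where
  "O_elem A = half * (D * (\<Sum>a\<in>set A. x a * e a) * prod_list (map e A)
     - prod_list (map e A) * (\<Sum>a\<in>set A. x a * e a) * D - eps * prod_list (map e A))"

lemma O_elem_single: "O_elem [k] = half * (eps * U k)"
proof -
  have "D * (x k * e k) * e k = eps * (D * x k)"
    by (simp add: mult.assoc e_square) (simp add: eps_central flip: mult.assoc)
  moreover have "e k * (x k * e k) * D = eps * (x k * D)"
    by (simp add: x_e) (simp add: e_square flip: mult.assoc)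
  ultimately show ?thesis
    by (simp add: O_elem_def U_def commutator_def right_diff_distrib)
qed

text \<open>Multiplying \<open>x i * e i + x j * e j\<close> by \<open>e i * e j\<close> gives
  \<epsilon> \<open>Z i j\<close> from the right, but the negative of it from the left. This sign
  turns the difference in \<open>O_elem\<close> into the anticommutator in \<open>V\<close>.\<close>

lemma O_elem_pair:
  assumes "i \<noteq> j"
  shows "O_elem [i, j] = half * (eps * V i j)"
proof -
  have ij: "e i * (e i * a) = eps * a" "e j * (e j * a) = eps * a"
    "e j * (e i * a) = - (e i * (e j * a))" for a
    using e_anticommute[OF assms] by (simp_all add: e_square flip: mult.assoc)
  have 1: "(x i * e i + x j * e j) * (e i * e j) = eps * Z i j"
  proof -
    have "x i * (eps * e j) = eps * (x i * e j)" "x j * (eps * e i) = eps * (x j * e i)"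
      by (metis mult.assoc eps_central)+
    thus ?thesis
      by (simp add: Z_def distrib_right right_diff_distrib mult.assoc ij e_square eps_central[of "e i"])
  qed
  have 2: "e i * e j * (x i * e i + x j * e j) = - (eps * Z i j)"
  proof -
    have "e i * (eps * x j) = eps * (e i * x j)"
      by (metis mult.assoc eps_central)
    thus ?thesis
      by (simp add: Z_def distrib_left right_diff_distrib mult.assoc x_e ij)
  qed
  have "O_elem [i, j] = half * (D * ((x i * e i + x j * e j) * (e i * e j))
      - e i * e j * (x i * e i + x j * e j) * D - eps * (e i * e j))"
    using assms by (simp add: O_elem_def mult.assoc)
  also have "\<dots> = half * (eps * V i j)"
    unfolding 1 2 by (simp add: V_def algebra_simps)
      (simp add: eps_central flip: mult.assoc)
  finally show ?thesis .
qed

text \<open>Both entries carry a factor \<open>eps\<close>, which is 1 or -1, so its square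
  disappears; \<open>half\<close> is central.\<close>

lemma commutator_O_elem:
  "commutator (half * (eps * a)) (half * (eps * b)) = half * half * commutator a b"
proof -
  have "half * (eps * a) * (half * (eps * b)) = half * half * (a * b)" for a b
    proof -
    have "a * (half * b) = half * (a * b)"
      by (metis mult.assoc half_central)
    thus ?thesis using eps_cases by (auto simp: mult.assoc)
  qed
  thus ?thesis by (simp add: commutator_def right_diff_distrib)
qed

theorem cyclic_O_elem:
  defines "O' \<equiv> \<lambda>i j. if i = j then 0 else O_elem [i, j]"
  shows "commutator (O' i j) (O_elem [k]) + commutator (O' j k) (O_elem [i])
    + commutator (O' k i) (O_elem [j]) = 0"
proof -
  \<comment> \<open>For \<open>a = b\<close> both sides are 0, so the scalars come out uniformly and
    coinciding indices need attention only for \<open>V\<close>.\<close>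
  have O': "O' a b = half * (eps * (if a = b then 0 else V a b))" for a b
    by (simp add: O'_def O_elem_pair)
  have "commutator (if i = j then 0 else V i j) (U k) + commutator (if j = k then 0 else V j k) (U i)
    + commutator (if k = i then 0 else V k i) (U j) = 0"
    using cyclic_V_U[of i j k] V_antisym[of i j] V_antisym[of i k]
    by (cases "i = j"; cases "j = k"; cases "i = k") (simp_all add: commutator_def)
  thus ?thesis
    unfolding O' O_elem_single commutator_O_elem by (simp flip: distrib_left)
qed

end

section \<open>Scalars and relations in the quotient algebras\<close>

lemma scalar_central: "scalar c * a = a * scalar c"
proof (induction a rule: update_induct)
  case const
  show ?case by simp
next
  case (update f a b)
  \<comment> \<open>The key \<open>a\<close> is new to \<open>f\<close>, so updating adds one
    monomial; a scalar commutes with it because its key is the unit 0 of the monoid.\<close>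
  have "Poly_Mapping.update a b f = f + Poly_Mapping.single a b"
    using update.hyps
    by (intro poly_mapping_eqI)
      (auto simp: lookup_update lookup_add lookup_single when_def in_keys_iff)
  with update.IH show ?case
    by (simp add: distrib_left distrib_right scalar_def mult_single mult.commute)
qed

lemma scalar_add: "scalar (c + d) = scalar c + scalar d"
  by (simp add: scalar_def single_add)

lemma scalar_one: "scalar 1 = 1"
  by (simp add: scalar_def)

lemma scalar_left_commute: "a * (scalar c * b) = scalar c * (a * b)"
  by (simp only: scalar_central[of c a] flip: mult.assoc)

lemma xp_x_commute: "xp_x i * xp_x j = xp_x j * xp_x i"
  by transfer (auto simp: ideal_eq_def xp_relators_def commutator_def intro!: tideal_base)

lemma xp_p_commute: "xp_p i * xp_p j = xp_p j * xp_p i"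
  by transfer (auto simp: ideal_eq_def xp_relators_def commutator_def intro!: tideal_base)

lemma abs_xp_alg_sum: "abs_xp_alg (sum f A) = (\<Sum>a\<in>A. abs_xp_alg (f a))"
  by (induction A rule: infinite_finite_induct)
    (simp_all add: plus_xp_alg.abs_eq[symmetric] zero_xp_alg.abs_eq[symmetric])

lemma xp_laplace_x:
  "commutator (xp_scale (1/2) (\<Sum>l\<in>UNIV. xp_p l * xp_p l)) (xp_x j)
    = (xp_p j :: ('n::finite, 'k::field_char_0) xp_alg)"
proof -
  have "(\<Sum>l\<in>UNIV. xp_p l * xp_p l) =
      (abs_xp_alg (\<Sum>l\<in>UNIV. gen (P l) ^ 2) :: ('n, 'k) xp_alg)"
    by (simp add: abs_xp_alg_sum xp_p.abs_eq times_xp_alg.abs_eq power2_eq_square)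
  moreover have "ideal_eq xp_relators
      (commutator (scalar (1/2 :: 'k) * (\<Sum>l\<in>UNIV. gen (P l) ^ 2)) (gen (X j))) (gen (P j))"
    unfolding ideal_eq_def by (rule tideal_base) (auto simp: xp_relators_def)
  ultimately show ?thesis
    by (simp add: commutator_def xp_scale.abs_eq xp_x.abs_eq xp_p.abs_eq times_xp_alg.abs_eq
      minus_xp_alg.abs_eq xp_alg.abs_eq_iff)
qed

lemma clifford_e_e:
  "clifford_e i * clifford_e j + clifford_e j * clifford_e i
    = (clifford_scale (2 * of_int (sign_of TYPE('s)) * (if i = j then 1 else 0)) 1
       :: ('n::finite, 's::sign, 'k::field_char_0) clifford)"
  unfolding clifford_e.abs_eq one_clifford_def map_fun_def id_apply clifford_scale.abs_eq
    times_clifford.abs_eq plus_clifford.abs_eq clifford.abs_eq_iff ideal_eq_def mult_1_right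
  by (rule tideal_base) (unfold clifford_relators_def, blast)

section \<open>Bilinearity and multiplication in the tensor product\<close>

lemma tensor_mult: "tensor a c * tensor a' c' = tensor (a * a') (c * c')"
  by (simp add: tensor_def times_xp_clifford.abs_eq mult_single)

lemma tensor_one: "tensor 1 1 = 1"
  by (simp add: tensor_def one_xp_clifford_def flip: zero_pure_def)

text \<open>This rule and the next three each correspond to one family of
  \<open>tensor_relators\<close>: the difference of the two sides is itself a relator, and the
  \<open>UnI\<close> rules select its family.\<close>

lemma tensor_add_left: "tensor (a + a') c = tensor a c + tensor a' c"
  unfolding tensor_def plus_xp_clifford.abs_eq xp_clifford.abs_eq_iff ideal_eq_def
    diff_diff_eq[symmetric]
  by (rule tideal_base) (unfold tensor_relators_def Let_def, rule UnI1, rule UnI1, rule UnI1,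
      intro UN_I[OF UNIV_I], rule singletonI)

lemma tensor_add_right: "tensor a (c + c') = tensor a c + tensor a c'"
  unfolding tensor_def plus_xp_clifford.abs_eq xp_clifford.abs_eq_iff ideal_eq_def
    diff_diff_eq[symmetric]
  by (rule tideal_base) (unfold tensor_relators_def Let_def, rule UnI1, rule UnI1, rule UnI2,
      intro UN_I[OF UNIV_I], rule singletonI)

lemma tensor_scale_left: "tensor (xp_scale r a) c = tensor_scale r (tensor a c)"
  unfolding tensor_def tensor_scale.abs_eq xp_clifford.abs_eq_iff ideal_eq_def
  by (rule tideal_base) (unfold tensor_relators_def Let_def, rule UnI1, rule UnI2,
      intro UN_I[OF UNIV_I], rule singletonI)

lemma tensor_scale_right: "tensor a (clifford_scale r c) = tensor_scale r (tensor a c)"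
  unfolding tensor_def tensor_scale.abs_eq xp_clifford.abs_eq_iff ideal_eq_def
  by (rule tideal_base) (unfold tensor_relators_def Let_def, rule UnI2,
      intro UN_I[OF UNIV_I], rule singletonI)

lemma tensor_scale_mult_left: "tensor_scale r a * b = tensor_scale r (a * b)"
  by transfer (simp add: mult.assoc ideal_eq_refl)

lemma tensor_scale_mult_right: "a * tensor_scale r b = tensor_scale r (a * b)"
  by transfer (simp only: scalar_left_commute ideal_eq_refl)

lemma tensor_scale_add: "tensor_scale (r + s) a = tensor_scale r a + tensor_scale s a"
  by transfer (simp add: ideal_eq_refl scalar_add distrib_right)

lemma tensor_scale_one: "tensor_scale 1 a = a"
  by transfer (simp add: ideal_eq_refl scalar_one)

lemma tensor_zero_left: "tensor 0 c = 0"
  using tensor_add_left[of 0 0 c] by simp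

lemma tensor_scale_zero: "tensor_scale 0 a = 0"
  using tensor_scale_add[of 0 0 a] by simp

lemma tensor_uminus_left: "tensor (- a) c = - tensor a c"
  using tensor_add_left[of a "- a" c] by (simp add: tensor_zero_left eq_neg_iff_add_eq_0 add.commute)

lemma tensor_diff_left: "tensor (a - a') c = tensor a c - tensor a' c"
  using tensor_add_left[of a "- a'" c] by (simp add: tensor_uminus_left)

lemma tensor_sum_left: "tensor (sum f A) c = (\<Sum>a\<in>A. tensor (f a) c)"
  by (induction A rule: infinite_finite_induct) (simp_all add: tensor_zero_left tensor_add_left)

text \<open>The relation \<open>xp_laplace_x\<close> is tensored with 1 and then added to itself,
  which absorbs the factor 1/2.\<close>

lemma xp_clifford_laplace_x:
  "commutator (\<Sum>l\<in>UNIV. pp l * pp l) (xx j)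
    = (pp j + pp j :: ('n::finite, 's::sign, 'k::field_char_0) xp_clifford)"
proof -
  define L :: "('n, 'k) xp_alg" where "L = (\<Sum>l\<in>UNIV. xp_p l * xp_p l)"
  have L: "(\<Sum>l\<in>UNIV. pp l * pp l) = (tensor L 1 :: ('n, 's, 'k) xp_clifford)"
    by (simp add: L_def pp_def tensor_mult tensor_sum_left)
  have "pp j = (tensor (commutator (xp_scale (1/2) L) (xp_x j)) 1 :: ('n, 's, 'k) xp_clifford)"
    by (simp add: pp_def L_def xp_laplace_x)
  also have "\<dots> = commutator (tensor (xp_scale (1/2) L) 1) (xx j)"
    by (simp add: commutator_def tensor_diff_left xx_def tensor_mult)
  also have "\<dots> = tensor_scale (1/2) 1 * commutator (tensor L 1) (xx j)"
    by (simp add: tensor_scale_left commutator_def right_diff_distrib tensor_scale_mult_left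
      tensor_scale_mult_right)
  finally have "pp j + pp j = (tensor_scale (1/2) 1 + tensor_scale (1/2) 1)
      * commutator (tensor L 1) (xx j :: ('n, 's, 'k) xp_clifford)"
    by (simp only: distrib_right)
  thus ?thesis
    by (simp add: L tensor_scale_one flip: tensor_scale_add)
qed

section \<open>Transfer of the identity to the tensor product\<close>

lemma clifford_momenta_xp_clifford:
  "clifford_momenta xx pp (ee :: 'n \<Rightarrow> ('n::finite, 's::sign, 'k::field_char_0) xp_clifford)
    (tensor_scale (of_int (sign_of TYPE('s))) 1) (tensor_scale (1/2) 1)"
proof
  fix i j :: 'n and a :: "('n, 's, 'k) xp_clifford"
  show "xx i * xx j = (xx j * xx i :: ('n, 's, 'k) xp_clifford)"
    by (simp add: xx_def tensor_mult xp_x_commute)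
  show "pp i * pp j = (pp j * pp i :: ('n, 's, 'k) xp_clifford)"
    by (simp add: pp_def tensor_mult xp_p_commute)
  show "xx i * ee j = (ee j * xx i :: ('n, 's, 'k) xp_clifford)"
    by (simp add: xx_def ee_def tensor_mult)
  show "pp i * ee j = (ee j * pp i :: ('n, 's, 'k) xp_clifford)"
    by (simp add: pp_def ee_def tensor_mult)
  show "ee i * ee j + ee j * ee i = (if i = j
      then tensor_scale (of_int (sign_of TYPE('s))) 1 + tensor_scale (of_int (sign_of TYPE('s))) 1
      else (0 :: ('n, 's, 'k) xp_clifford))"
    by (simp add: ee_def tensor_mult clifford_e_e tensor_scale_right tensor_one tensor_scale_zero
      flip: tensor_add_right tensor_scale_add)
  show "commutator (\<Sum>l\<in>UNIV. pp l * pp l) (xx j) = (pp j + pp j :: ('n, 's, 'k) xp_clifford)"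
    by (rule xp_clifford_laplace_x)
  have "tensor_scale (- 1) 1 = (- 1 :: ('n, 's, 'k) xp_clifford)"
    using tensor_scale_add[of 1 "- 1" "1 :: ('n, 's, 'k) xp_clifford"]
    by (simp add: tensor_scale_zero tensor_scale_one eq_neg_iff_add_eq_0 add.commute)
  thus "tensor_scale (of_int (sign_of TYPE('s))) 1 = (1 :: ('n, 's, 'k) xp_clifford) \<or>
      tensor_scale (of_int (sign_of TYPE('s))) 1 = (- 1 :: ('n, 's, 'k) xp_clifford)"
    using sign_of_cases[where 'a = 's] by (auto simp: tensor_scale_one)
  show "tensor_scale (1/2) 1 * a = a * tensor_scale (1/2) 1"
    by (simp add: tensor_scale_mult_left tensor_scale_mult_right)
  show "tensor_scale (1/2) 1 + tensor_scale (1/2) 1 = (1 :: ('n, 's, 'k) xp_clifford)"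
    by (simp add: tensor_scale_one flip: tensor_scale_add)
qed

theorem theorem3p11:
  fixes i j k :: "'n::finite"
  shows "commutator (O2 i j) (O1 k) + commutator (O2 j k) (O1 i) + commutator (O2 k i) (O1 j)
           = (0 :: ('n, 's::sign, 'k::real_normed_field) xp_clifford)"
proof -
  interpret clifford_momenta xx pp "ee :: 'n \<Rightarrow> ('n, 's, 'k) xp_clifford"
    "tensor_scale (of_int (sign_of TYPE('s))) 1" "tensor_scale (1/2) 1"
    by (rule clifford_momenta_xp_clifford)
  \<comment> \<open>Scaling by \<open>c\<close> is multiplication by
    \<open>tensor_scale c 1\<close>, the form in which \<open>half\<close> and \<open>eps\<close>
    are interpreted.\<close>
  have "O_list = O_elem"
    by (rule ext) (simp add: O_list_def O_elem_def DD_def D_def x_list_def e_list_def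
      tensor_scale_mult_left)
  thus ?thesis
    unfolding O1_def O2_def using cyclic_O_elem[of i j k] by (simp only:)
qed

end
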